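(* Let $D$ be a division algebra over a field $F$, let $k,n,m\in\mathbb N$ and let $B \cong M_k(D)$. Suppose $B = \sum_{i=1}^n \sum_{j=1}^m B_{ij}$, a (not necessarily direct) sum of subspaces $B_{ij}$ of $B$, with $B_{ij} B_{\ell r} \subseteq B_{ir}$ for all $1\leqslant i,\ell \leqslant n$, $1\leqslant j,r \leqslant m$. Let $P=(p_{j\ell})$ be an $m\times n$ matrix with entries $p_{j\ell}\in \{ \theta,e\}$ such that $B_{ij} B_{\ell r}=0$ for all $i,r$ and every $(j,\ell)$ with $p_{j\ell} = \theta$. Then there exists an $\mathcal{M}(\{ e\}^{0},n,m;P)$-graded algebra $A=\bigoplus_{i=1}^n \bigoplus_{j=1}^m A_{ij}$ and a surjective algebra homomorphism $\psi \colon A \rightarrow B$ such that $\ker \psi = J(A)$ and $\psi(A_{ij})=B_{ij}$ for all $1\leqslant i \leqslant n$, $1\leqslant j \leqslant m$.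
   Context: Algebras are associative $F$-algebras, not necessarily unital; $J(A)$ is the Jacobson radical. $\mathcal{M}(\{e\}^0,n,m;P)=\{(e,i,j)\mid 1\leqslant i\leqslant n,\ 1\leqslant j\leqslant m\}\cup\{\theta\}$ is the Rees matrix semigroup with zero $\theta$ and product $(e,i,j)(e,k,\ell)=(e,i,\ell)$ if $p_{jk}=e$ and $=\theta$ if $p_{jk}=\theta$. For an $\mathcal{M}(\{e\}^0,n,m;P)$-graded algebra $A=\bigoplus_{i,j}A_{ij}$, $A_{ij}$ is the homogeneous component of degree $(e,i,j)$ (a subspace) and the component of degree $\theta$ is zero; i.e. $A_{ij}A_{k\ell}\subseteq A_{i\ell}$ and $A_{ij}A_{k\ell}=0$ whenever $p_{jk}=\theta$. *)

theory Defs
  imports "HOL-Algebra.Module" "HOL-Algebra.AbelCoset"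
begin

section \<open>Associative algebras, not necessarily unital\<close>

text \<open>The locale \<^locale>\<open>algebra\<close> of HOL-Algebra is commutative and unital, so it cannot be used here.
  The field \<^const>\<open>one\<close> of the record is left unconstrained.\<close>

locale assoc_algebra = K?: field F + module F A for F (structure) and A (structure) +
  assumes mult_closed:
      "\<lbrakk>x \<in> carrier A; y \<in> carrier A\<rbrakk> \<Longrightarrow> x \<otimes>\<^bsub>A\<^esub> y \<in> carrier A"
    and mult_assoc:
      "\<lbrakk>x \<in> carrier A; y \<in> carrier A; z \<in> carrier A\<rbrakk> \<Longrightarrow>
        (x \<otimes>\<^bsub>A\<^esub> y) \<otimes>\<^bsub>A\<^esub> z = x \<otimes>\<^bsub>A\<^esub> (y \<otimes>\<^bsub>A\<^esub> z)"
    and mult_l_distr: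
      "\<lbrakk>x \<in> carrier A; y \<in> carrier A; z \<in> carrier A\<rbrakk> \<Longrightarrow>
        (x \<oplus>\<^bsub>A\<^esub> y) \<otimes>\<^bsub>A\<^esub> z = x \<otimes>\<^bsub>A\<^esub> z \<oplus>\<^bsub>A\<^esub> y \<otimes>\<^bsub>A\<^esub> z"
    and mult_r_distr:
      "\<lbrakk>x \<in> carrier A; y \<in> carrier A; z \<in> carrier A\<rbrakk> \<Longrightarrow>
        x \<otimes>\<^bsub>A\<^esub> (y \<oplus>\<^bsub>A\<^esub> z) = x \<otimes>\<^bsub>A\<^esub> y \<oplus>\<^bsub>A\<^esub> x \<otimes>\<^bsub>A\<^esub> z"
    and smult_mult_l:
      "\<lbrakk>c \<in> carrier F; x \<in> carrier A; y \<in> carrier A\<rbrakk> \<Longrightarrow>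
        (c \<odot>\<^bsub>A\<^esub> x) \<otimes>\<^bsub>A\<^esub> y = c \<odot>\<^bsub>A\<^esub> (x \<otimes>\<^bsub>A\<^esub> y)"
    and smult_mult_r:
      "\<lbrakk>c \<in> carrier F; x \<in> carrier A; y \<in> carrier A\<rbrakk> \<Longrightarrow>
        x \<otimes>\<^bsub>A\<^esub> (c \<odot>\<^bsub>A\<^esub> y) = c \<odot>\<^bsub>A\<^esub> (x \<otimes>\<^bsub>A\<^esub> y)"

locale division_algebra = assoc_algebra F D + D?: ring D for F (structure) and D (structure) +
  assumes Units_eq: "Units D = carrier D - {\<zero>\<^bsub>D\<^esub>}"

text \<open>Homomorphisms are not required to preserve \<^const>\<open>one\<close>.\<close>

definition alg_hom ::
  "('f, 'x) ring_scheme \<Rightarrow> ('f, 'a, 'y) module_scheme \<Rightarrow> ('f, 'b, 'z) module_scheme \<Rightarrow> ('a \<Rightarrow> 'b) set"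
  where "alg_hom F A B =
    {h \<in> carrier A \<rightarrow> carrier B.
      (\<forall>x\<in>carrier A. \<forall>y\<in>carrier A. h (x \<oplus>\<^bsub>A\<^esub> y) = h x \<oplus>\<^bsub>B\<^esub> h y) \<and>
      (\<forall>x\<in>carrier A. \<forall>y\<in>carrier A. h (x \<otimes>\<^bsub>A\<^esub> y) = h x \<otimes>\<^bsub>B\<^esub> h y) \<and>
      (\<forall>c\<in>carrier F. \<forall>x\<in>carrier A. h (c \<odot>\<^bsub>A\<^esub> x) = c \<odot>\<^bsub>B\<^esub> h x)}"

definition alg_isomorphic ::
  "('f, 'x) ring_scheme \<Rightarrow> ('f, 'a, 'y) module_scheme \<Rightarrow> ('f, 'b, 'z) module_scheme \<Rightarrow> bool"
  where "alg_isomorphic F A B \<longleftrightarrow> (\<exists>h\<in>alg_hom F A B. bij_betw h (carrier A) (carrier B))"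

text \<open>A \<open>k \<times> k\<close> matrix is a function on \<open>{1..k} \<times> {1..k}\<close>, extended by \<^const>\<open>undefined\<close>
  elsewhere so that equality of matrices is equality of functions.\<close>

definition mat_algebra ::
  "nat \<Rightarrow> ('f, 'd, 'y) module_scheme \<Rightarrow> ('f, nat \<times> nat \<Rightarrow> 'd) module"
  where "mat_algebra k D =
    \<lparr>carrier = {1..k} \<times> {1..k} \<rightarrow>\<^sub>E carrier D,
     mult = (\<lambda>X Y. \<lambda>(i, j)\<in>{1..k} \<times> {1..k}. \<Oplus>\<^bsub>D\<^esub>l\<in>{1..k}. X (i, l) \<otimes>\<^bsub>D\<^esub> Y (l, j)),
     one = (\<lambda>(i, j)\<in>{1..k} \<times> {1..k}. if i = j then \<one>\<^bsub>D\<^esub> else \<zero>\<^bsub>D\<^esub>),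
     zero = (\<lambda>p\<in>{1..k} \<times> {1..k}. \<zero>\<^bsub>D\<^esub>),
     add = (\<lambda>X Y. \<lambda>p\<in>{1..k} \<times> {1..k}. X p \<oplus>\<^bsub>D\<^esub> Y p),
     smult = (\<lambda>c X. \<lambda>p\<in>{1..k} \<times> {1..k}. c \<odot>\<^bsub>D\<^esub> X p)\<rparr>"

definition sum_of_family :: "('a, 'x) ring_scheme \<Rightarrow> 'i set \<Rightarrow> ('i \<Rightarrow> 'a set) \<Rightarrow> 'a set"
  where "sum_of_family A I V = {\<Oplus>\<^bsub>A\<^esub>i\<in>I. v i | v. v \<in> Pi I V}"


section \<open>The Jacobson radical\<close>

definition left_ideal ::
  "('f, 'x) ring_scheme \<Rightarrow> ('f, 'a, 'y) module_scheme \<Rightarrow> 'a set \<Rightarrow> bool"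
  where "left_ideal F A L \<longleftrightarrow>
    submodule L F A \<and> (\<forall>a\<in>carrier A. \<forall>x\<in>L. a \<otimes>\<^bsub>A\<^esub> x \<in> L)"

definition maximal_left_ideal ::
  "('f, 'x) ring_scheme \<Rightarrow> ('f, 'a, 'y) module_scheme \<Rightarrow> 'a set \<Rightarrow> bool"
  where "maximal_left_ideal F A L \<longleftrightarrow>
    left_ideal F A L \<and> L \<noteq> carrier A \<and>
    (\<forall>L'. left_ideal F A L' \<longrightarrow> L \<subseteq> L' \<longrightarrow> L' = L \<or> L' = carrier A)"

definition modular ::
  "('f, 'a, 'y) module_scheme \<Rightarrow> 'a set \<Rightarrow> bool"
  where "modular A L \<longleftrightarrow> (\<exists>e\<in>carrier A. \<forall>a\<in>carrier A. a \<ominus>\<^bsub>A\<^esub> a \<otimes>\<^bsub>A\<^esub> e \<in> L)"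

text \<open>For an algebra without identity, the radical is the intersection of the \<^emph>\<open>modular\<close> (also
  called regular) maximal left ideals, and the whole algebra if there are none. Without modularity
  the intersection would be a different set.\<close>

definition jacobson_radical ::
  "('f, 'x) ring_scheme \<Rightarrow> ('f, 'a, 'y) module_scheme \<Rightarrow> 'a set"
  where "jacobson_radical F A =
    carrier A \<inter> \<Inter>{L. maximal_left_ideal F A L \<and> modular A L}"


section \<open>Algebras graded by a Rees matrix semigroup\<close>

text \<open>The elements of \<open>{e}\<^sup>0\<close>, used as entries of the sandwich matrix.\<close>

datatype entry = Entry_e | Entry_theta

text \<open>\<open>Deg i j\<close> is the element \<open>(e, i, j)\<close>.\<close>

datatype rees = Deg nat nat | Theta

definition rees_carrier :: "nat \<Rightarrow> nat \<Rightarrow> rees set"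
  where "rees_carrier n m = insert Theta {Deg i j | i j. i \<in> {1..n} \<and> j \<in> {1..m}}"

fun rees_mult :: "(nat \<Rightarrow> nat \<Rightarrow> entry) \<Rightarrow> rees \<Rightarrow> rees \<Rightarrow> rees"
  where
    "rees_mult P (Deg i j) (Deg k l) = (if P j k = Entry_e then Deg i l else Theta)"
  | "rees_mult P Theta t = Theta"
  | "rees_mult P s Theta = Theta"

lemma rees_mult_closed:
  "\<lbrakk>s \<in> rees_carrier n m; t \<in> rees_carrier n m\<rbrakk> \<Longrightarrow> rees_mult P s t \<in> rees_carrier n m"
  by (cases s; cases t) (auto simp: rees_carrier_def)

lemma rees_mult_assoc: "rees_mult P (rees_mult P s t) u = rees_mult P s (rees_mult P t u)"
  by (cases s; cases t; cases u) auto

lemma finite_rees_carrier: "finite (rees_carrier n m)"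
proof -
  have "rees_carrier n m = insert Theta ((\<lambda>(i, j). Deg i j) ` ({1..n} \<times> {1..m}))"
    by (auto simp: rees_carrier_def)
  then show ?thesis by simp
qed

text \<open>A grading by a finite semigroup with underlying set \<open>S\<close> and product \<open>f\<close>. For infinite \<open>S\<close>
  the sum \<^const>\<open>finsum\<close> below would not be meaningful.\<close>

definition graded_algebra ::
  "('f, 'x) ring_scheme \<Rightarrow> ('f, 'a, 'y) module_scheme \<Rightarrow> 's set \<Rightarrow> ('s \<Rightarrow> 's \<Rightarrow> 's) \<Rightarrow> ('s \<Rightarrow> 'a set) \<Rightarrow> bool"
  where "graded_algebra F A S f V \<longleftrightarrow>
    assoc_algebra F A \<and>
    (\<forall>s\<in>S. submodule (V s) F A) \<and>
    (\<forall>a\<in>carrier A. \<exists>!v. v \<in> Pi\<^sub>E S V \<and> a = (\<Oplus>\<^bsub>A\<^esub>s\<in>S. v s)) \<and>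
    (\<forall>s\<in>S. \<forall>t\<in>S. \<forall>x\<in>V s. \<forall>y\<in>V t. x \<otimes>\<^bsub>A\<^esub> y \<in> V (f s t))"

definition rees_graded_algebra ::
  "('f, 'x) ring_scheme \<Rightarrow> ('f, 'a, 'y) module_scheme \<Rightarrow> nat \<Rightarrow> nat \<Rightarrow> (nat \<Rightarrow> nat \<Rightarrow> entry)
    \<Rightarrow> (rees \<Rightarrow> 'a set) \<Rightarrow> bool"
  where "rees_graded_algebra F A n m P V \<longleftrightarrow>
    graded_algebra F A (rees_carrier n m) (rees_mult P) V \<and> V Theta = {\<zero>\<^bsub>A\<^esub>}"

end

theory Submission
  imports Defs
begin

text \<open>Let \<open>A\<close> be the external direct sum of the \<open>B\<^sub>i\<^sub>j\<close> and \<open>\<psi>\<close> the summation map. In \<open>A\<close> the product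
  \<open>x k y\<close> has \<open>(i, r)\<close> component (sum of row \<open>i\<close> of \<open>x\<close>) \<open>\<psi> k\<close> (sum of column \<open>r\<close> of \<open>y\<close>), so
  \<open>A (ker \<psi>) A = 0\<close> and the kernel lies in the radical. Conversely, composing \<open>\<psi>\<close> with the isomorphism
  onto \<open>M\<^sub>k(D)\<close> and pulling back the left ideals of matrices with a vanishing column gives maximal
  modular left ideals of \<open>A\<close> whose intersection is \<open>ker \<psi>\<close>.\<close>

section \<open>Additive maps and finite sums\<close>

text \<open>Only additivity is asked of \<open>h\<close>, so the consequences below serve algebra
  homomorphisms, one-sided multiplications and evaluations at an index pair alike.\<close>

lemma additive_group_hom:
  assumes "abelian_group G" "abelian_group H" "h \<in> carrier G \<rightarrow> carrier H"
    and "\<And>x y. \<lbrakk>x \<in> carrier G; y \<in> carrier G\<rbrakk> \<Longrightarrow> h (x \<oplus>\<^bsub>G\<^esub> y) = h x \<oplus>\<^bsub>H\<^esub> h y"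
  shows "group_hom (add_monoid G) (add_monoid H) h"
  using assms
  by (auto simp: group_hom_def group_hom_axioms_def hom_def abelian_group.a_group)

lemma additive_zero:
  assumes "abelian_group G" "abelian_group H" "h \<in> carrier G \<rightarrow> carrier H"
    and "\<And>x y. \<lbrakk>x \<in> carrier G; y \<in> carrier G\<rbrakk> \<Longrightarrow> h (x \<oplus>\<^bsub>G\<^esub> y) = h x \<oplus>\<^bsub>H\<^esub> h y"
  shows "h \<zero>\<^bsub>G\<^esub> = \<zero>\<^bsub>H\<^esub>"
  using group_hom.hom_one[OF additive_group_hom[OF assms]] by simp

lemma additive_a_inv:
  assumes "abelian_group G" "abelian_group H" "h \<in> carrier G \<rightarrow> carrier H"
    and "\<And>x y. \<lbrakk>x \<in> carrier G; y \<in> carrier G\<rbrakk> \<Longrightarrow> h (x \<oplus>\<^bsub>G\<^esub> y) = h x \<oplus>\<^bsub>H\<^esub> h y"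
    and "x \<in> carrier G"
  shows "h (\<ominus>\<^bsub>G\<^esub> x) = \<ominus>\<^bsub>H\<^esub> h x"
  using group_hom.hom_inv[OF additive_group_hom[OF assms(1-4)]] assms(5)
  by (simp add: a_inv_def)

text \<open>No finiteness of \<open>S\<close> is assumed: over an infinite set both sums are zero by
  convention, and \<open>h\<close> preserves zero.\<close>

lemma additive_finsum:
  assumes G: "abelian_group G" and H: "abelian_group H" and h: "h \<in> carrier G \<rightarrow> carrier H"
    and add: "\<And>x y. \<lbrakk>x \<in> carrier G; y \<in> carrier G\<rbrakk> \<Longrightarrow> h (x \<oplus>\<^bsub>G\<^esub> y) = h x \<oplus>\<^bsub>H\<^esub> h y"
    and f: "f \<in> S \<rightarrow> carrier G"
  shows "h (\<Oplus>\<^bsub>G\<^esub>s\<in>S. f s) = (\<Oplus>\<^bsub>H\<^esub>s\<in>S. h (f s))"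
proof -
  interpret G: abelian_group G by fact
  interpret H: abelian_group H by fact
  have zero: "h \<zero>\<^bsub>G\<^esub> = \<zero>\<^bsub>H\<^esub>"
    using additive_zero[OF G H h add] .
  show ?thesis
    using f
  proof (induction S rule: infinite_finite_induct)
    case (insert s S)
    then have "f \<in> S \<rightarrow> carrier G" "f s \<in> carrier G"
      by auto
    moreover from this have "(\<lambda>s. h (f s)) \<in> S \<rightarrow> carrier H" "h (f s) \<in> carrier H"
      using h by auto
    ultimately show ?case
      using insert by (simp add: add)
  qed (simp_all add: zero)
qed

section \<open>Iterated finite sums and sums with a single nonzero term\<close>

context abelian_monoid
begin

lemma finsum_swap:
  assumes "finite S" "finite T" "\<And>s t. \<lbrakk>s \<in> S; t \<in> T\<rbrakk> \<Longrightarrow> f s t \<in> carrier G"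
  shows "(\<Oplus>s\<in>S. \<Oplus>t\<in>T. f s t) = (\<Oplus>t\<in>T. \<Oplus>s\<in>S. f s t)"
  using assms(1,3)
proof (induction S rule: finite_induct)
  case (insert a S)
  have "(\<Oplus>t\<in>T. \<Oplus>s\<in>insert a S. f s t) = (\<Oplus>t\<in>T. f a t \<oplus> (\<Oplus>s\<in>S. f s t))"
    using insert by (intro finsum_cong') (auto intro!: finsum_closed a_closed)
  also have "\<dots> = (\<Oplus>t\<in>T. f a t) \<oplus> (\<Oplus>t\<in>T. \<Oplus>s\<in>S. f s t)"
    using insert by (intro finsum_addf) (auto intro!: finsum_closed)
  also have "\<dots> = (\<Oplus>s\<in>insert a S. \<Oplus>t\<in>T. f s t)"
    using insert by (auto intro!: finsum_insert[symmetric] finsum_closed)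
  finally show ?case ..
qed simp

lemma finsum_Times:
  assumes "finite S" "finite T" "\<And>s t. \<lbrakk>s \<in> S; t \<in> T\<rbrakk> \<Longrightarrow> f (s, t) \<in> carrier G"
  shows "(\<Oplus>p\<in>S \<times> T. f p) = (\<Oplus>s\<in>S. \<Oplus>t\<in>T. f (s, t))"
proof -
  have "S \<times> T = (\<Union>s\<in>S. Pair s ` T)"
    by auto
  then have "(\<Oplus>p\<in>S \<times> T. f p) = (\<Oplus>s\<in>S. finsum G f (Pair s ` T))"
    using assms by (auto simp: pairwise_def disjnt_def intro!: add.finprod_UN_disjoint)
  also have "\<dots> = (\<Oplus>s\<in>S. \<Oplus>t\<in>T. f (s, t))"
    using assms
    by (intro finsum_cong') (auto intro!: finsum_closed finsum_reindex inj_onI)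
  finally show ?thesis .
qed

text \<open>Used for matrices with one nonzero column and for families supported at one index
  pair.\<close>

lemma finsum_eq_single:
  assumes "finite S" "a \<in> S" "f a \<in> carrier G" "\<And>s. \<lbrakk>s \<in> S; s \<noteq> a\<rbrakk> \<Longrightarrow> f s = \<zero>"
  shows "(\<Oplus>s\<in>S. f s) = f a"
proof -
  have f: "f \<in> S \<rightarrow> carrier G"
    using assms by (metis Pi_I zero_closed)
  have "(\<Oplus>s\<in>S. f s) = (\<Oplus>s\<in>S. if a = s then f s else \<zero>)"
    using assms f by (intro finsum_cong') auto
  also have "\<dots> = f a"
    using assms f by (intro finsum_singleton)
  finally show ?thesis .
qed

end

lemma (in module) submodule_finsum_closed:
  assumes N: "submodule N R M" and f: "f \<in> S \<rightarrow> N"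
  shows "(\<Oplus>\<^bsub>M\<^esub>s\<in>S. f s) \<in> N"
proof -
  have N': "N \<subseteq> carrier M" "\<zero>\<^bsub>M\<^esub> \<in> N"
    using submoduleE[OF N] submodule.axioms(1)[OF N] subgroup.one_closed by fastforce+
  show ?thesis
    using f
  proof (induction S rule: infinite_finite_induct)
    case (insert s S)
    then have "f s \<in> N" "(\<Oplus>\<^bsub>M\<^esub>s\<in>S. f s) \<in> N" "f \<in> insert s S \<rightarrow> carrier M"
      using N' by auto
    then show ?case
      using insert submoduleE(5)[OF N] N' by (simp add: Pi_iff)
  qed (use N' in simp_all)
qed

section \<open>The Jacobson radical\<close>

context assoc_algebra
begin

text \<open>Multiplication by a fixed element is additive by distributivity, hence sends zero to
  zero; the same view gives the next three lemmas.\<close>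

lemma mult_r_zero [simp]: "x \<in> carrier A \<Longrightarrow> x \<otimes>\<^bsub>A\<^esub> \<zero>\<^bsub>A\<^esub> = \<zero>\<^bsub>A\<^esub>"
  by (rule additive_zero[of A A]) (auto simp: M.abelian_group_axioms mult_closed mult_r_distr)

lemma mult_l_zero [simp]: "x \<in> carrier A \<Longrightarrow> \<zero>\<^bsub>A\<^esub> \<otimes>\<^bsub>A\<^esub> x = \<zero>\<^bsub>A\<^esub>"
  by (rule additive_zero[of A A "\<lambda>y. y \<otimes>\<^bsub>A\<^esub> x"])
    (auto simp: M.abelian_group_axioms mult_closed mult_l_distr)

lemma mult_finsum_right:
  "\<lbrakk>x \<in> carrier A; f \<in> S \<rightarrow> carrier A\<rbrakk> \<Longrightarrow>
    x \<otimes>\<^bsub>A\<^esub> (\<Oplus>\<^bsub>A\<^esub>s\<in>S. f s) = (\<Oplus>\<^bsub>A\<^esub>s\<in>S. x \<otimes>\<^bsub>A\<^esub> f s)"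
  by (rule additive_finsum[of A A]) (auto simp: M.abelian_group_axioms mult_closed mult_r_distr)

lemma mult_finsum_left:
  "\<lbrakk>x \<in> carrier A; f \<in> S \<rightarrow> carrier A\<rbrakk> \<Longrightarrow>
    (\<Oplus>\<^bsub>A\<^esub>s\<in>S. f s) \<otimes>\<^bsub>A\<^esub> x = (\<Oplus>\<^bsub>A\<^esub>s\<in>S. f s \<otimes>\<^bsub>A\<^esub> x)"
  by (rule additive_finsum[of A A "\<lambda>y. y \<otimes>\<^bsub>A\<^esub> x"])
    (auto simp: M.abelian_group_axioms mult_closed mult_l_distr)

lemma left_idealD:
  assumes "left_ideal F A L"
  shows "L \<subseteq> carrier A" "\<zero>\<^bsub>A\<^esub> \<in> L"
    "\<And>x y. \<lbrakk>x \<in> L; y \<in> L\<rbrakk> \<Longrightarrow> x \<oplus>\<^bsub>A\<^esub> y \<in> L"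
    "\<And>x. x \<in> L \<Longrightarrow> \<ominus>\<^bsub>A\<^esub> x \<in> L"
    "\<And>c x. \<lbrakk>c \<in> carrier F; x \<in> L\<rbrakk> \<Longrightarrow> c \<odot>\<^bsub>A\<^esub> x \<in> L"
    "\<And>a x. \<lbrakk>a \<in> carrier A; x \<in> L\<rbrakk> \<Longrightarrow> a \<otimes>\<^bsub>A\<^esub> x \<in> L"
proof -
  have L: "submodule L F A"
    using assms by (simp add: left_ideal_def)
  show "\<zero>\<^bsub>A\<^esub> \<in> L"
    using submodule.axioms(1)[OF L] subgroup.one_closed by fastforce
qed (use assms submoduleE[of L] in \<open>auto simp: left_ideal_def\<close>)

text \<open>This is the ideal to which maximality is applied when a left ideal is added to a maximal
  one; every closure property holds summand by summand.\<close>

lemma left_ideal_sum: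
  assumes L: "left_ideal F A L" and K: "left_ideal F A K"
  shows "left_ideal F A {l \<oplus>\<^bsub>A\<^esub> k | l k. l \<in> L \<and> k \<in> K}" (is "left_ideal F A ?S")
proof -
  have carr: "\<And>l. l \<in> L \<Longrightarrow> l \<in> carrier A" "\<And>k. k \<in> K \<Longrightarrow> k \<in> carrier A"
    using left_idealD(1)[OF L] left_idealD(1)[OF K] by blast+
  have mem: "x \<in> ?S" if "x = l \<oplus>\<^bsub>A\<^esub> k" "l \<in> L" "k \<in> K" for x l k
    using that by blast
  have "submodule ?S F A"
  proof (rule submoduleI)
    show "?S \<subseteq> carrier A"
      using carr by blast
    show "\<zero>\<^bsub>A\<^esub> \<in> ?S"
      by (rule mem[OF _ left_idealD(2)[OF L] left_idealD(2)[OF K]]) simp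
  next
    fix a assume "a \<in> ?S"
    then obtain l k where a: "a = l \<oplus>\<^bsub>A\<^esub> k" and lk: "l \<in> L" "k \<in> K"
      by blast
    show "\<ominus>\<^bsub>A\<^esub> a \<in> ?S"
      by (rule mem[OF _ left_idealD(4)[OF L lk(1)] left_idealD(4)[OF K lk(2)]])
        (use lk carr in \<open>simp add: a M.minus_add\<close>)
  next
    fix a b assume "a \<in> ?S" "b \<in> ?S"
    then obtain l k l' k' where ab: "a = l \<oplus>\<^bsub>A\<^esub> k" "b = l' \<oplus>\<^bsub>A\<^esub> k'"
      and lk: "l \<in> L" "k \<in> K" "l' \<in> L" "k' \<in> K"
      by blast
    show "a \<oplus>\<^bsub>A\<^esub> b \<in> ?S"
      by (rule mem[OF _ left_idealD(3)[OF L lk(1,3)] left_idealD(3)[OF K lk(2,4)]])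
        (use lk carr in \<open>simp add: ab M.a_ac\<close>)
  next
    fix c a assume c: "c \<in> carrier F" and "a \<in> ?S"
    then obtain l k where a: "a = l \<oplus>\<^bsub>A\<^esub> k" and lk: "l \<in> L" "k \<in> K"
      by blast
    show "c \<odot>\<^bsub>A\<^esub> a \<in> ?S"
      by (rule mem[OF _ left_idealD(5)[OF L c lk(1)] left_idealD(5)[OF K c lk(2)]])
        (use lk carr c in \<open>simp add: a smult_r_distr\<close>)
  qed
  moreover have "a \<otimes>\<^bsub>A\<^esub> x \<in> ?S" if a: "a \<in> carrier A" and "x \<in> ?S" for a x
  proof -
    from that obtain l k where x: "x = l \<oplus>\<^bsub>A\<^esub> k" and lk: "l \<in> L" "k \<in> K"
      by blast
    show ?thesis
      by (rule mem[OF _ left_idealD(6)[OF L a lk(1)] left_idealD(6)[OF K a lk(2)]])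
        (use lk carr a in \<open>simp add: x mult_r_distr\<close>)
  qed
  ultimately show ?thesis
    unfolding left_ideal_def by blast
qed

text \<open>If \<open>K\<close> is not inside a maximal left ideal \<open>L\<close> with right identity \<open>e\<close> modulo \<open>L\<close>, then
  \<open>e = l + k\<close>, so that \<open>k\<close> is also a right identity modulo \<open>L\<close>; applying it twice kills
  everything.\<close>

lemma nil_left_ideal_subset_radical:
  assumes K: "left_ideal F A K"
    and nil: "\<And>a k. \<lbrakk>a \<in> carrier A; k \<in> K\<rbrakk> \<Longrightarrow> (a \<otimes>\<^bsub>A\<^esub> k) \<otimes>\<^bsub>A\<^esub> k = \<zero>\<^bsub>A\<^esub>"
  shows "K \<subseteq> jacobson_radical F A"
proof -
  have "K \<subseteq> L" if max: "maximal_left_ideal F A L" and mod: "modular A L" for L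
  proof (rule ccontr)
    assume nsub: "\<not> K \<subseteq> L"
    have L: "left_ideal F A L" and ne: "L \<noteq> carrier A"
      using max by (auto simp: maximal_left_ideal_def)
    have Lc: "\<And>l. l \<in> L \<Longrightarrow> l \<in> carrier A" and Kc: "\<And>k. k \<in> K \<Longrightarrow> k \<in> carrier A"
      using left_idealD(1)[OF L] left_idealD(1)[OF K] by blast+
    let ?S = "{l \<oplus>\<^bsub>A\<^esub> k | l k. l \<in> L \<and> k \<in> K}"
    have mem: "x \<in> ?S" if "x = l \<oplus>\<^bsub>A\<^esub> k" "l \<in> L" "k \<in> K" for x l k
      using that by blast
    have "L \<subseteq> ?S"
      using mem[OF _ _ left_idealD(2)[OF K]] Lc by (simp add: subsetI)
    \<comment> \<open>Maximality leaves two cases, and \<open>?S = L\<close> would put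
      \<open>K\<close> inside \<open>L\<close>.\<close>
    then have "?S = L \<or> ?S = carrier A"
      using max left_ideal_sum[OF L K] by (simp add: maximal_left_ideal_def)
    moreover have "K \<subseteq> ?S"
      using mem[OF _ left_idealD(2)[OF L]] Kc by (simp add: subsetI)
    then have "?S \<noteq> L"
      using nsub by (intro notI) simp
    ultimately have S: "?S = carrier A"
      by simp
    obtain e where e: "e \<in> carrier A"
      and mod_e: "\<And>a. a \<in> carrier A \<Longrightarrow> a \<ominus>\<^bsub>A\<^esub> a \<otimes>\<^bsub>A\<^esub> e \<in> L"
      using mod unfolding modular_def by blast
    obtain l k where lk: "l \<in> L" "k \<in> K" and e_eq: "e = l \<oplus>\<^bsub>A\<^esub> k"
      using e S by blast
    note lkc = Lc[OF lk(1)] Kc[OF lk(2)]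
    \<comment> \<open>Since \<open>e = l + k\<close>, one has \<open>a - ak = (a - ae) + al\<close>,
      and \<open>al\<close> lies in \<open>L\<close> because \<open>L\<close> is a left
      ideal.\<close>
    have mod_k: "a \<ominus>\<^bsub>A\<^esub> a \<otimes>\<^bsub>A\<^esub> k \<in> L" if a: "a \<in> carrier A" for a
    proof -
      have "a \<otimes>\<^bsub>A\<^esub> e = a \<otimes>\<^bsub>A\<^esub> l \<oplus>\<^bsub>A\<^esub> a \<otimes>\<^bsub>A\<^esub> k"
        using a lkc by (simp add: e_eq mult_r_distr)
      then have "(a \<ominus>\<^bsub>A\<^esub> a \<otimes>\<^bsub>A\<^esub> e) \<oplus>\<^bsub>A\<^esub> a \<otimes>\<^bsub>A\<^esub> l
          = (a \<ominus>\<^bsub>A\<^esub> a \<otimes>\<^bsub>A\<^esub> k) \<oplus>\<^bsub>A\<^esub> (\<ominus>\<^bsub>A\<^esub> (a \<otimes>\<^bsub>A\<^esub> l) \<oplus>\<^bsub>A\<^esub> a \<otimes>\<^bsub>A\<^esub> l)"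
        using a lkc by (simp add: M.minus_eq M.minus_add mult_closed M.a_ac)
      also have "\<dots> = a \<ominus>\<^bsub>A\<^esub> a \<otimes>\<^bsub>A\<^esub> k"
        using a lkc by (simp add: mult_closed M.l_neg)
      finally show ?thesis
        using left_idealD(3)[OF L mod_e[OF a] left_idealD(6)[OF L a lk(1)]] by simp
    qed
    have absorb: "a \<in> L" if a: "a \<in> carrier A" and ak: "a \<otimes>\<^bsub>A\<^esub> k \<in> L" for a
    proof -
      have "(a \<ominus>\<^bsub>A\<^esub> a \<otimes>\<^bsub>A\<^esub> k) \<oplus>\<^bsub>A\<^esub> a \<otimes>\<^bsub>A\<^esub> k = a"
        using a lkc by (simp add: M.minus_eq M.a_assoc mult_closed M.l_neg)
      then show ?thesis
        using left_idealD(3)[OF L mod_k[OF a] ak] by simp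
    qed
    \<comment> \<open>From \<open>(ak)k = 0\<close> in \<open>L\<close>, \<open>absorb\<close> first
      gives \<open>ak\<close> in \<open>L\<close> and then \<open>a\<close> in \<open>L\<close>, so
      \<open>L\<close> would be the whole algebra.\<close>
    have "a \<in> L" if a: "a \<in> carrier A" for a
      using absorb[OF a absorb[OF mult_closed[OF a lkc(2)]]] nil[OF a lk(2)] left_idealD(2)[OF L]
      by simp
    then show False
      using ne left_idealD(1)[OF L] by auto
  qed
  then show ?thesis
    using left_idealD(1)[OF K] unfolding jacobson_radical_def by blast
qed

end

text \<open>The matrices with vanishing \<open>q\<close>-th column form a maximal modular left ideal, and these
  left ideals intersect in zero.\<close>

lemma jacobson_radical_matrix_entry_zero:
  assumes A: "assoc_algebra F A" and D: "division_algebra F D"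
    and hom: "h \<in> alg_hom F A (mat_algebra k D)"
    and surj: "h ` carrier A = carrier (mat_algebra k D)"
    and x: "x \<in> jacobson_radical F A"
    and pq: "p \<in> {1..k}" "q \<in> {1..k}"
  shows "h x (p, q) = \<zero>\<^bsub>D\<^esub>"
proof -
  interpret A: assoc_algebra F A by fact
  interpret R: ring D
    using D by (simp add: division_algebra_def)
  interpret D: division_algebra F D by fact
  have hc: "h a (i, j) \<in> carrier D" if "a \<in> carrier A" "i \<in> {1..k}" "j \<in> {1..k}" for a i j
  proof -
    have "h \<in> carrier A \<rightarrow> ({1..k} \<times> {1..k} \<rightarrow>\<^sub>E carrier D)"
      using hom by (simp add: alg_hom_def mat_algebra_def)
    then have "h a \<in> {1..k} \<times> {1..k} \<rightarrow>\<^sub>E carrier D"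
      using that(1) by (rule funcset_mem)
    then show ?thesis
      using that(2,3) by (rule PiE_mem[OF _ SigmaI])
  qed
  have h_add: "h (a \<oplus>\<^bsub>A\<^esub> b) (i, j) = h a (i, j) \<oplus>\<^bsub>D\<^esub> h b (i, j)"
    if "a \<in> carrier A" "b \<in> carrier A" "i \<in> {1..k}" "j \<in> {1..k}" for a b i j
    using hom that by (simp add: alg_hom_def mat_algebra_def)
  have h_smult: "h (c \<odot>\<^bsub>A\<^esub> a) (i, j) = c \<odot>\<^bsub>D\<^esub> h a (i, j)"
    if "c \<in> carrier F" "a \<in> carrier A" "i \<in> {1..k}" "j \<in> {1..k}" for c a i j
    using hom that by (simp add: alg_hom_def mat_algebra_def)
  have h_mult: "h (a \<otimes>\<^bsub>A\<^esub> b) (i, j) = (\<Oplus>\<^bsub>D\<^esub>l\<in>{1..k}. h a (i, l) \<otimes>\<^bsub>D\<^esub> h b (l, j))"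
    if "a \<in> carrier A" "b \<in> carrier A" "i \<in> {1..k}" "j \<in> {1..k}" for a b i j
    using hom that by (simp add: alg_hom_def mat_algebra_def)
  have h_zero: "h \<zero>\<^bsub>A\<^esub> (i, j) = \<zero>\<^bsub>D\<^esub>" if "i \<in> {1..k}" "j \<in> {1..k}" for i j
    using that
    by (intro additive_zero[where h = "\<lambda>a. h a (i, j)", OF A.M.abelian_group_axioms R.abelian_group_axioms])
      (auto simp: hc h_add)
  have h_inv: "h (\<ominus>\<^bsub>A\<^esub> a) (i, j) = \<ominus>\<^bsub>D\<^esub> h a (i, j)"
    if "a \<in> carrier A" "i \<in> {1..k}" "j \<in> {1..k}" for a i j
    using that
    by (intro additive_a_inv[where h = "\<lambda>a. h a (i, j)", OF A.M.abelian_group_axioms R.abelian_group_axioms])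
      (auto simp: hc h_add)
  \<comment> \<open>Take a preimage of the matrix with column \<open>s\<close> equal to
    \<open>d\<close> and zeros elsewhere: left multiplication by it sees only row \<open>s\<close>
    of the other factor and scales it by \<open>d i\<close> into row \<open>i\<close>.\<close>
  have elementary: "\<exists>a\<in>carrier A. \<forall>b\<in>carrier A. \<forall>i\<in>{1..k}. \<forall>j\<in>{1..k}.
      h (a \<otimes>\<^bsub>A\<^esub> b) (i, j) = d i \<otimes>\<^bsub>D\<^esub> h b (s, j)"
    if d: "\<And>i. i \<in> {1..k} \<Longrightarrow> d i \<in> carrier D" and s: "s \<in> {1..k}" for d s
  proof -
    have "(\<lambda>(i, j)\<in>{1..k} \<times> {1..k}. if j = s then d i else \<zero>\<^bsub>D\<^esub>) \<in> carrier (mat_algebra k D)"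
      using d by (auto simp: mat_algebra_def)
    then obtain a where a: "a \<in> carrier A"
      and ha: "h a = (\<lambda>(i, j)\<in>{1..k} \<times> {1..k}. if j = s then d i else \<zero>\<^bsub>D\<^esub>)"
      using surj by (metis (no_types, lifting) imageE)
    have "h (a \<otimes>\<^bsub>A\<^esub> b) (i, j) = d i \<otimes>\<^bsub>D\<^esub> h b (s, j)"
      if "b \<in> carrier A" "i \<in> {1..k}" "j \<in> {1..k}" for b i j
    proof -
      have "h (a \<otimes>\<^bsub>A\<^esub> b) (i, j) = (\<Oplus>\<^bsub>D\<^esub>l\<in>{1..k}. h a (i, l) \<otimes>\<^bsub>D\<^esub> h b (l, j))"
        using a that by (rule h_mult)
      also have "\<dots> = h a (i, s) \<otimes>\<^bsub>D\<^esub> h b (s, j)"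
        using that s d by (intro R.finsum_eq_single) (auto simp: ha hc)
      finally show ?thesis
        using that s by (simp add: ha)
    qed
    with a show ?thesis by blast
  qed
  let ?L = "{a \<in> carrier A. \<forall>i\<in>{1..k}. h a (i, q) = \<zero>\<^bsub>D\<^esub>}"
  have L: "left_ideal F A ?L"
    unfolding left_ideal_def
  proof (intro conjI ballI)
    show "submodule ?L F A"
      using pq by (intro A.submoduleI) (auto simp: h_zero h_inv h_add h_smult)
  next
    fix a b assume a: "a \<in> carrier A" and b: "b \<in> ?L"
    have "h (a \<otimes>\<^bsub>A\<^esub> b) (i, q) = \<zero>\<^bsub>D\<^esub>" if i: "i \<in> {1..k}" for i
    proof -
      have "h (a \<otimes>\<^bsub>A\<^esub> b) (i, q) = (\<Oplus>\<^bsub>D\<^esub>l\<in>{1..k}. h a (i, l) \<otimes>\<^bsub>D\<^esub> h b (l, q))"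
        using a b i pq by (intro h_mult) auto
      also have "\<dots> = (\<Oplus>\<^bsub>D\<^esub>l\<in>{1..k}. \<zero>\<^bsub>D\<^esub>)"
        using a b i by (intro R.finsum_cong') (auto simp: hc)
      finally show ?thesis by simp
    qed
    then show "a \<otimes>\<^bsub>A\<^esub> b \<in> ?L"
      using a b by (simp add: A.mult_closed)
  qed
  have mod: "modular A ?L"
  proof -
    \<comment> \<open>Right multiplication by the matrix unit at \<open>(q, q)\<close> preserves
      column \<open>q\<close>, so any preimage of it is a right identity modulo
      \<open>?L\<close>.\<close>
    have "(\<lambda>(i, j)\<in>{1..k} \<times> {1..k}. if i = q \<and> j = q then \<one>\<^bsub>D\<^esub> else \<zero>\<^bsub>D\<^esub>) \<in> carrier (mat_algebra k D)"
      by (auto simp: mat_algebra_def)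
    then obtain e where e: "e \<in> carrier A"
      and he: "h e = (\<lambda>(i, j)\<in>{1..k} \<times> {1..k}. if i = q \<and> j = q then \<one>\<^bsub>D\<^esub> else \<zero>\<^bsub>D\<^esub>)"
      using surj by (metis (no_types, lifting) imageE)
    have "h (a \<ominus>\<^bsub>A\<^esub> a \<otimes>\<^bsub>A\<^esub> e) (i, q) = \<zero>\<^bsub>D\<^esub>" if a: "a \<in> carrier A" and i: "i \<in> {1..k}" for a i
    proof -
      have "h (a \<otimes>\<^bsub>A\<^esub> e) (i, q) = (\<Oplus>\<^bsub>D\<^esub>l\<in>{1..k}. h a (i, l) \<otimes>\<^bsub>D\<^esub> h e (l, q))"
        using a e i pq by (intro h_mult)
      also have "\<dots> = h a (i, q) \<otimes>\<^bsub>D\<^esub> h e (q, q)"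
        using a i pq by (intro R.finsum_eq_single) (auto simp: he hc)
      also have "\<dots> = h a (i, q)"
        using a i pq by (simp add: he hc)
      finally show ?thesis
        using a e i pq by (simp add: A.M.minus_eq h_add h_inv A.mult_closed hc R.r_neg)
    qed
    then show ?thesis
      using e unfolding modular_def by (intro bexI[of _ e]) (auto simp: A.mult_closed)
  qed
  show ?thesis
  proof (rule ccontr)
    assume nz: "h x (p, q) \<noteq> \<zero>\<^bsub>D\<^esub>"
    have xc: "x \<in> carrier A"
      using x by (simp add: jacobson_radical_def)
    \<comment> \<open>The element \<open>x\<close> itself witnesses that \<open>?L\<close> is
      proper.\<close>
    have "x \<notin> ?L"
      using nz pq by blast
    then have ne: "?L \<noteq> carrier A"
      using xc by blast
    have "L' = ?L \<or> L' = carrier A" if L': "left_ideal F A L'" and sub: "?L \<subseteq> L'" for L'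
    proof (rule disjCI)
      assume "L' \<noteq> carrier A"
      have "y \<in> ?L" if "y \<in> L'" for y
      proof (rule ccontr)
        assume "y \<notin> ?L"
        moreover have yc: "y \<in> carrier A"
          using A.left_idealD(1)[OF L'] that by blast
        ultimately obtain s where s: "s \<in> {1..k}" and ys: "h y (s, q) \<noteq> \<zero>\<^bsub>D\<^esub>"
          by blast
        have u: "h y (s, q) \<in> Units D"
          using ys hc[OF yc s pq(2)] by (simp add: D.Units_eq)
        have "a \<in> L'" if a: "a \<in> carrier A" for a
        proof -
          \<comment> \<open>The entry of \<open>h y\<close> at \<open>(s, q)\<close> is nonzero,
            hence invertible. Scaling row \<open>s\<close> by column \<open>q\<close> of
            \<open>h a\<close> times this inverse gives \<open>c y\<close> the same column
            \<open>q\<close> as \<open>a\<close>. Thus \<open>a - cy\<close> lies in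
            \<open>?L\<close> and \<open>cy\<close> in \<open>L'\<close>, which forces
            \<open>a\<close> into \<open>L'\<close>.\<close>
          obtain c where c: "c \<in> carrier A"
            and hcy: "\<And>b i j. \<lbrakk>b \<in> carrier A; i \<in> {1..k}; j \<in> {1..k}\<rbrakk> \<Longrightarrow>
              h (c \<otimes>\<^bsub>A\<^esub> b) (i, j) = (h a (i, q) \<otimes>\<^bsub>D\<^esub> inv\<^bsub>D\<^esub> h y (s, q)) \<otimes>\<^bsub>D\<^esub> h b (s, j)"
            using elementary[of "\<lambda>i. h a (i, q) \<otimes>\<^bsub>D\<^esub> inv\<^bsub>D\<^esub> h y (s, q)" s] s a pq u
            by (auto simp: hc)
          have "h (c \<otimes>\<^bsub>A\<^esub> y) (i, q) = h a (i, q)" if "i \<in> {1..k}" for i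
            using that a pq u yc s by (simp add: hcy R.m_assoc hc)
          then have "a \<ominus>\<^bsub>A\<^esub> c \<otimes>\<^bsub>A\<^esub> y \<in> ?L"
            using a c yc pq by (simp add: A.M.minus_eq h_add h_inv A.mult_closed hc R.r_neg)
          then have "(a \<ominus>\<^bsub>A\<^esub> c \<otimes>\<^bsub>A\<^esub> y) \<oplus>\<^bsub>A\<^esub> c \<otimes>\<^bsub>A\<^esub> y \<in> L'"
            using sub by (intro A.left_idealD(3)[OF L'] A.left_idealD(6)[OF L' c \<open>y \<in> L'\<close>]) blast
          moreover have "(a \<ominus>\<^bsub>A\<^esub> c \<otimes>\<^bsub>A\<^esub> y) \<oplus>\<^bsub>A\<^esub> c \<otimes>\<^bsub>A\<^esub> y = a"
            using a c yc by (simp add: A.M.minus_eq A.M.a_assoc A.mult_closed A.M.l_neg)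
          ultimately show ?thesis by simp
        qed
        then show False
          using A.left_idealD(1)[OF L'] \<open>L' \<noteq> carrier A\<close> by blast
      qed
      then show "L' = ?L"
        using sub by blast
    qed
    then have "maximal_left_ideal F A ?L"
      using L ne unfolding maximal_left_ideal_def by blast
    then show False
      using x mod \<open>x \<notin> ?L\<close> unfolding jacobson_radical_def by blast
  qed
qed

section \<open>The external direct sum of the summands\<close>

text \<open>Only the rule that products keep the outer indices is imposed on the family. That it
  spans \<open>B\<close>, and that some products vanish, enters later as a hypothesis of individual
  lemmas.\<close>

locale rectangular_family = assoc_algebra F B for F (structure) and B (structure) +
  fixes I :: "'i set" and J :: "'j set" and C :: "'i \<Rightarrow> 'j \<Rightarrow> 'c set"
  assumes fin_I: "finite I" and fin_J: "finite J"
    and submod: "\<lbrakk>i \<in> I; j \<in> J\<rbrakk> \<Longrightarrow> submodule (C i j) F B"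
    and mult_mem: "\<lbrakk>i \<in> I; j \<in> J; l \<in> I; r \<in> J; x \<in> C i j; y \<in> C l r\<rbrakk> \<Longrightarrow> x \<otimes>\<^bsub>B\<^esub> y \<in> C i r"
begin

definition row :: "('i \<times> 'j \<Rightarrow> 'c) \<Rightarrow> 'i \<Rightarrow> 'c"
  where "row x i = (\<Oplus>\<^bsub>B\<^esub>j\<in>J. x (i, j))"

definition col :: "('i \<times> 'j \<Rightarrow> 'c) \<Rightarrow> 'j \<Rightarrow> 'c"
  where "col x j = (\<Oplus>\<^bsub>B\<^esub>i\<in>I. x (i, j))"

definition total :: "('i \<times> 'j \<Rightarrow> 'c) \<Rightarrow> 'c"
  where "total x = (\<Oplus>\<^bsub>B\<^esub>p\<in>I \<times> J. x p)"

text \<open>The \<open>(i, r)\<close> entry of a product collects all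
  \<open>x (i, j) y (l, r)\<close> over \<open>j\<close> and \<open>l\<close>, and this double sum
  factors as a row sum times a column sum. Families are extensional, so they are equal when their
  entries are. The algebra need not have an identity, hence \<open>one = undefined\<close>.\<close>

definition ext_sum :: "('a, 'i \<times> 'j \<Rightarrow> 'c) module"
  where "ext_sum =
    \<lparr>carrier = Pi\<^sub>E (I \<times> J) (\<lambda>(i, j). C i j),
     mult = (\<lambda>x y. \<lambda>(i, r)\<in>I \<times> J. row x i \<otimes>\<^bsub>B\<^esub> col y r),
     one = undefined,
     zero = (\<lambda>p\<in>I \<times> J. \<zero>\<^bsub>B\<^esub>),
     add = (\<lambda>x y. \<lambda>p\<in>I \<times> J. x p \<oplus>\<^bsub>B\<^esub> y p),
     smult = (\<lambda>c x. \<lambda>p\<in>I \<times> J. c \<odot>\<^bsub>B\<^esub> x p)\<rparr>"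

lemma C_closed:
  assumes "i \<in> I" "j \<in> J"
  shows "x \<in> C i j \<Longrightarrow> x \<in> carrier B" "\<zero>\<^bsub>B\<^esub> \<in> C i j"
    "\<lbrakk>x \<in> C i j; y \<in> C i j\<rbrakk> \<Longrightarrow> x \<oplus>\<^bsub>B\<^esub> y \<in> C i j"
    "x \<in> C i j \<Longrightarrow> \<ominus>\<^bsub>B\<^esub> x \<in> C i j"
    "\<lbrakk>c \<in> carrier F; x \<in> C i j\<rbrakk> \<Longrightarrow> c \<odot>\<^bsub>B\<^esub> x \<in> C i j"
proof -
  note C = submod[OF assms]
  show "\<zero>\<^bsub>B\<^esub> \<in> C i j"
    using submodule.axioms(1)[OF C] subgroup.one_closed by fastforce
qed (use submoduleE[OF submod[OF assms]] in auto)

lemma ext_sum_memD: "\<lbrakk>x \<in> carrier ext_sum; i \<in> I; j \<in> J\<rbrakk> \<Longrightarrow> x (i, j) \<in> C i j"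
  by (force simp: ext_sum_def)

lemma ext_sum_closed: "\<lbrakk>x \<in> carrier ext_sum; i \<in> I; j \<in> J\<rbrakk> \<Longrightarrow> x (i, j) \<in> carrier B"
  using C_closed(1) ext_sum_memD by blast

lemma ext_sum_memI:
  "\<lbrakk>\<And>i j. \<lbrakk>i \<in> I; j \<in> J\<rbrakk> \<Longrightarrow> f (i, j) \<in> C i j\<rbrakk> \<Longrightarrow> restrict f (I \<times> J) \<in> carrier ext_sum"
  by (auto simp: ext_sum_def)

lemma ext_sum_eqI:
  assumes "x \<in> carrier ext_sum" "y \<in> carrier ext_sum"
    and "\<And>i j. \<lbrakk>i \<in> I; j \<in> J\<rbrakk> \<Longrightarrow> x (i, j) = y (i, j)"
  shows "x = y"
  using assms by (intro PiE_ext[of x "I \<times> J" _ y]) (auto simp: ext_sum_def)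

lemma ext_sum_apply [simp]:
  assumes "i \<in> I" "j \<in> J"
  shows "(x \<oplus>\<^bsub>ext_sum\<^esub> y) (i, j) = x (i, j) \<oplus>\<^bsub>B\<^esub> y (i, j)"
    and "\<zero>\<^bsub>ext_sum\<^esub> (i, j) = \<zero>\<^bsub>B\<^esub>"
    and "(c \<odot>\<^bsub>ext_sum\<^esub> x) (i, j) = c \<odot>\<^bsub>B\<^esub> x (i, j)"
    and "(x \<otimes>\<^bsub>ext_sum\<^esub> y) (i, j) = row x i \<otimes>\<^bsub>B\<^esub> col y j"
  using assms by (simp_all add: ext_sum_def)

section \<open>Row, column and total sums of a family\<close>

lemma row_closed [simp]: "\<lbrakk>x \<in> carrier ext_sum; i \<in> I\<rbrakk> \<Longrightarrow> row x i \<in> carrier B"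
  unfolding row_def by (auto intro!: M.finsum_closed ext_sum_closed)

lemma col_closed [simp]: "\<lbrakk>x \<in> carrier ext_sum; j \<in> J\<rbrakk> \<Longrightarrow> col x j \<in> carrier B"
  unfolding col_def by (auto intro!: M.finsum_closed ext_sum_closed)

lemma total_closed [simp]: "x \<in> carrier ext_sum \<Longrightarrow> total x \<in> carrier B"
  unfolding total_def by (auto intro!: M.finsum_closed ext_sum_closed)

lemma total_eq_sum_row: "x \<in> carrier ext_sum \<Longrightarrow> total x = (\<Oplus>\<^bsub>B\<^esub>i\<in>I. row x i)"
  unfolding total_def row_def using fin_I fin_J
  by (intro M.finsum_Times) (auto intro: ext_sum_closed)

lemma total_eq_sum_col: "x \<in> carrier ext_sum \<Longrightarrow> total x = (\<Oplus>\<^bsub>B\<^esub>j\<in>J. col x j)"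
  unfolding total_eq_sum_row row_def col_def using fin_I fin_J
  by (intro M.finsum_swap) (auto intro: ext_sum_closed)

text \<open>Expanding both sums leaves terms \<open>x (i, j) y (l, r)\<close>, each in
  \<open>C i r\<close> whatever the inner indices \<open>j\<close> and \<open>l\<close> are. This
  makes the product of \<open>ext_sum\<close> well defined.\<close>

lemma row_mult_col_mem:
  assumes x: "x \<in> carrier ext_sum" and y: "y \<in> carrier ext_sum" and i: "i \<in> I" and r: "r \<in> J"
  shows "row x i \<otimes>\<^bsub>B\<^esub> col y r \<in> C i r"
proof -
  have "row x i \<otimes>\<^bsub>B\<^esub> col y r = (\<Oplus>\<^bsub>B\<^esub>j\<in>J. x (i, j) \<otimes>\<^bsub>B\<^esub> col y r)"
    unfolding row_def using assms by (intro mult_finsum_left) (auto intro: ext_sum_closed)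
  also have "\<dots> \<in> C i r"
  proof (intro submodule_finsum_closed submod i r funcsetI)
    fix j assume j: "j \<in> J"
    have "x (i, j) \<otimes>\<^bsub>B\<^esub> col y r = (\<Oplus>\<^bsub>B\<^esub>l\<in>I. x (i, j) \<otimes>\<^bsub>B\<^esub> y (l, r))"
      unfolding col_def using assms j by (intro mult_finsum_right) (auto intro: ext_sum_closed)
    also have "\<dots> \<in> C i r"
      using assms j
      by (intro submodule_finsum_closed submod) (auto intro: mult_mem ext_sum_memD)
    finally show "x (i, j) \<otimes>\<^bsub>B\<^esub> col y r \<in> C i r" .
  qed
  finally show ?thesis .
qed

lemma ext_sum_ops_closed:
  assumes "x \<in> carrier ext_sum" "y \<in> carrier ext_sum"
  shows "x \<oplus>\<^bsub>ext_sum\<^esub> y \<in> carrier ext_sum" "x \<otimes>\<^bsub>ext_sum\<^esub> y \<in> carrier ext_sum"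
    "\<zero>\<^bsub>ext_sum\<^esub> \<in> carrier ext_sum"
    "c \<in> carrier F \<Longrightarrow> c \<odot>\<^bsub>ext_sum\<^esub> x \<in> carrier ext_sum"
proof -
  show "x \<oplus>\<^bsub>ext_sum\<^esub> y \<in> carrier ext_sum"
    using ext_sum_memI[of "\<lambda>p. x p \<oplus>\<^bsub>B\<^esub> y p"] assms
    by (simp add: C_closed ext_sum_memD) (simp add: ext_sum_def)
  show "x \<otimes>\<^bsub>ext_sum\<^esub> y \<in> carrier ext_sum"
    using ext_sum_memI[of "\<lambda>(i, r). row x i \<otimes>\<^bsub>B\<^esub> col y r"] assms
    by (simp add: row_mult_col_mem) (simp add: ext_sum_def)
  show "\<zero>\<^bsub>ext_sum\<^esub> \<in> carrier ext_sum"
    using ext_sum_memI[of "\<lambda>p. \<zero>\<^bsub>B\<^esub>"] by (simp add: C_closed) (simp add: ext_sum_def)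
  show "c \<odot>\<^bsub>ext_sum\<^esub> x \<in> carrier ext_sum" if "c \<in> carrier F"
    using ext_sum_memI[of "\<lambda>p. c \<odot>\<^bsub>B\<^esub> x p"] assms that
    by (simp add: C_closed ext_sum_memD) (simp add: ext_sum_def)
qed

text \<open>In \<open>row_mult\<close>, summing over the second index affects only the right factor,
  whose column sums add up to \<open>total y\<close>.\<close>

lemma row_linear:
  assumes "x \<in> carrier ext_sum" "y \<in> carrier ext_sum" "i \<in> I"
  shows row_add: "row (x \<oplus>\<^bsub>ext_sum\<^esub> y) i = row x i \<oplus>\<^bsub>B\<^esub> row y i"
    and row_smult: "c \<in> carrier F \<Longrightarrow> row (c \<odot>\<^bsub>ext_sum\<^esub> x) i = c \<odot>\<^bsub>B\<^esub> row x i"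
    and row_mult: "row (x \<otimes>\<^bsub>ext_sum\<^esub> y) i = row x i \<otimes>\<^bsub>B\<^esub> total y"
proof -
  have "row (x \<oplus>\<^bsub>ext_sum\<^esub> y) i = (\<Oplus>\<^bsub>B\<^esub>j\<in>J. x (i, j) \<oplus>\<^bsub>B\<^esub> y (i, j))"
    unfolding row_def using assms by (intro M.finsum_cong') (auto simp: ext_sum_closed)
  also have "\<dots> = row x i \<oplus>\<^bsub>B\<^esub> row y i"
    unfolding row_def using assms by (intro M.finsum_addf) (auto simp: ext_sum_closed)
  finally show "row (x \<oplus>\<^bsub>ext_sum\<^esub> y) i = row x i \<oplus>\<^bsub>B\<^esub> row y i" .
  show "row (c \<odot>\<^bsub>ext_sum\<^esub> x) i = c \<odot>\<^bsub>B\<^esub> row x i" if "c \<in> carrier F"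
    unfolding row_def using assms fin_J that
    by (subst finsum_smult_ldistr) (auto intro!: M.finsum_cong' simp: ext_sum_closed)
  have "row (x \<otimes>\<^bsub>ext_sum\<^esub> y) i = (\<Oplus>\<^bsub>B\<^esub>r\<in>J. row x i \<otimes>\<^bsub>B\<^esub> col y r)"
    unfolding row_def[of "x \<otimes>\<^bsub>ext_sum\<^esub> y"] using assms
    by (intro M.finsum_cong') (auto simp: mult_closed)
  then show "row (x \<otimes>\<^bsub>ext_sum\<^esub> y) i = row x i \<otimes>\<^bsub>B\<^esub> total y"
    using assms by (simp add: total_eq_sum_col mult_finsum_right Pi_iff)
qed

text \<open>The mirror image: in \<open>col_mult\<close> the row sums of the left factor add up to
  \<open>total x\<close>.\<close>

lemma col_linear:
  assumes "x \<in> carrier ext_sum" "y \<in> carrier ext_sum" "r \<in> J"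
  shows col_add: "col (x \<oplus>\<^bsub>ext_sum\<^esub> y) r = col x r \<oplus>\<^bsub>B\<^esub> col y r"
    and col_smult: "c \<in> carrier F \<Longrightarrow> col (c \<odot>\<^bsub>ext_sum\<^esub> x) r = c \<odot>\<^bsub>B\<^esub> col x r"
    and col_mult: "col (x \<otimes>\<^bsub>ext_sum\<^esub> y) r = total x \<otimes>\<^bsub>B\<^esub> col y r"
proof -
  have "col (x \<oplus>\<^bsub>ext_sum\<^esub> y) r = (\<Oplus>\<^bsub>B\<^esub>i\<in>I. x (i, r) \<oplus>\<^bsub>B\<^esub> y (i, r))"
    unfolding col_def using assms by (intro M.finsum_cong') (auto simp: ext_sum_closed)
  also have "\<dots> = col x r \<oplus>\<^bsub>B\<^esub> col y r"
    unfolding col_def using assms by (intro M.finsum_addf) (auto simp: ext_sum_closed)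
  finally show "col (x \<oplus>\<^bsub>ext_sum\<^esub> y) r = col x r \<oplus>\<^bsub>B\<^esub> col y r" .
  show "col (c \<odot>\<^bsub>ext_sum\<^esub> x) r = c \<odot>\<^bsub>B\<^esub> col x r" if "c \<in> carrier F"
    unfolding col_def using assms fin_I that
    by (subst finsum_smult_ldistr) (auto intro!: M.finsum_cong' simp: ext_sum_closed)
  have "col (x \<otimes>\<^bsub>ext_sum\<^esub> y) r = (\<Oplus>\<^bsub>B\<^esub>i\<in>I. row x i \<otimes>\<^bsub>B\<^esub> col y r)"
    unfolding col_def[of "x \<otimes>\<^bsub>ext_sum\<^esub> y"] using assms
    by (intro M.finsum_cong') (auto simp: mult_closed)
  then show "col (x \<otimes>\<^bsub>ext_sum\<^esub> y) r = total x \<otimes>\<^bsub>B\<^esub> col y r"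
    using assms by (simp add: total_eq_sum_row mult_finsum_left Pi_iff)
qed

text \<open>For products, summing \<open>row_mult\<close> over all rows turns \<open>row x i\<close>
  into \<open>total x\<close>.\<close>

lemma total_in_alg_hom: "total \<in> alg_hom F ext_sum B"
  unfolding alg_hom_def
proof (intro CollectI conjI ballI funcsetI)
  fix x y assume xy: "x \<in> carrier ext_sum" "y \<in> carrier ext_sum"
  show "total (x \<oplus>\<^bsub>ext_sum\<^esub> y) = total x \<oplus>\<^bsub>B\<^esub> total y"
  proof -
    have "total (x \<oplus>\<^bsub>ext_sum\<^esub> y) = (\<Oplus>\<^bsub>B\<^esub>i\<in>I. row x i \<oplus>\<^bsub>B\<^esub> row y i)"
      unfolding total_eq_sum_row[OF ext_sum_ops_closed(1)[OF xy]] using xy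
      by (intro M.finsum_cong') (auto simp: row_add)
    also have "\<dots> = total x \<oplus>\<^bsub>B\<^esub> total y"
      unfolding total_eq_sum_row[OF xy(1)] total_eq_sum_row[OF xy(2)] using xy
      by (intro M.finsum_addf) auto
    finally show ?thesis .
  qed
  have "total (x \<otimes>\<^bsub>ext_sum\<^esub> y) = (\<Oplus>\<^bsub>B\<^esub>i\<in>I. row x i \<otimes>\<^bsub>B\<^esub> total y)"
    unfolding total_eq_sum_row[OF ext_sum_ops_closed(2)[OF xy]] using xy
    by (intro M.finsum_cong') (auto simp: row_mult mult_closed)
  also have "\<dots> = total x \<otimes>\<^bsub>B\<^esub> total y"
    unfolding total_eq_sum_row[OF xy(1)] using xy
    by (intro mult_finsum_left[symmetric]) auto
  finally show "total (x \<otimes>\<^bsub>ext_sum\<^esub> y) = total x \<otimes>\<^bsub>B\<^esub> total y" .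
next
  fix c x assume cx: "c \<in> carrier F" "x \<in> carrier ext_sum"
  have "total (c \<odot>\<^bsub>ext_sum\<^esub> x) = (\<Oplus>\<^bsub>B\<^esub>i\<in>I. c \<odot>\<^bsub>B\<^esub> row x i)"
    unfolding total_eq_sum_row[OF ext_sum_ops_closed(4)[OF cx(2,2,1)]] using cx
    by (intro M.finsum_cong') (auto simp: row_smult)
  then show "total (c \<odot>\<^bsub>ext_sum\<^esub> x) = c \<odot>\<^bsub>B\<^esub> total x"
    using cx fin_I by (simp add: total_eq_sum_row finsum_smult_ldistr Pi_iff)
qed simp

text \<open>The module laws hold entrywise. For associativity, either bracketing of
  \<open>x\<close>, \<open>y\<close>, \<open>z\<close> has \<open>(i, r)\<close> entry
  \<open>row x i\<close> times \<open>total y\<close> times \<open>col z r\<close>.\<close>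

lemma assoc_algebra_ext_sum: "assoc_algebra F ext_sum"
proof -
  have "module F ext_sum"
  proof (rule moduleI)
    show "abelian_group ext_sum"
    proof (rule abelian_groupI)
      fix x assume x: "x \<in> carrier ext_sum"
      let ?y = "restrict (\<lambda>p. \<ominus>\<^bsub>B\<^esub> x p) (I \<times> J)"
      have y: "?y \<in> carrier ext_sum"
        using x by (intro ext_sum_memI C_closed ext_sum_memD)
      moreover have "?y \<oplus>\<^bsub>ext_sum\<^esub> x = \<zero>\<^bsub>ext_sum\<^esub>"
        using x y by (intro ext_sum_eqI ext_sum_ops_closed[OF y x])
          (simp_all add: ext_sum_closed M.l_neg)
      ultimately show "\<exists>y\<in>carrier ext_sum. y \<oplus>\<^bsub>ext_sum\<^esub> x = \<zero>\<^bsub>ext_sum\<^esub>"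
        by blast
    next
      \<comment> \<open>The closure facts of \<open>ext_sum_ops_closed\<close> presuppose elements
        of the carrier, and none is at hand here.\<close>
      show "\<zero>\<^bsub>ext_sum\<^esub> \<in> carrier ext_sum"
        using ext_sum_memI[of "\<lambda>p. \<zero>\<^bsub>B\<^esub>"] by (simp add: C_closed) (simp add: ext_sum_def)
    qed (auto intro!: ext_sum_eqI intro: ext_sum_ops_closed simp: ext_sum_closed M.a_ac)
  qed (auto intro!: ext_sum_eqI intro: ext_sum_ops_closed module.axioms(1)[OF module_axioms]
      simp: ext_sum_closed smult_l_distr smult_r_distr smult_assoc1)
  moreover have "assoc_algebra_axioms F ext_sum"
    by (rule assoc_algebra_axioms.intro)
      (auto intro!: ext_sum_eqI intro: ext_sum_ops_closed
        simp: row_linear col_linear mult_assoc mult_l_distr mult_r_distr smult_mult_l smult_mult_r)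
  ultimately show ?thesis
    by (intro assoc_algebra.intro K.field_axioms)
qed

section \<open>The kernel of the summation map and the radical\<close>

lemma total_zero: "total \<zero>\<^bsub>ext_sum\<^esub> = \<zero>\<^bsub>B\<^esub>"
  unfolding total_def by (simp add: ext_sum_def cong: M.finsum_cong)

lemma left_ideal_kernel_total: "left_ideal F ext_sum (a_kernel ext_sum B total)"
proof -
  interpret E: assoc_algebra F ext_sum
    by (rule assoc_algebra_ext_sum)
  have add: "total (x \<oplus>\<^bsub>ext_sum\<^esub> y) = total x \<oplus>\<^bsub>B\<^esub> total y"
    and mult: "total (x \<otimes>\<^bsub>ext_sum\<^esub> y) = total x \<otimes>\<^bsub>B\<^esub> total y"
    and smult: "c \<in> carrier F \<Longrightarrow> total (c \<odot>\<^bsub>ext_sum\<^esub> x) = c \<odot>\<^bsub>B\<^esub> total x"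
    if "x \<in> carrier ext_sum" "y \<in> carrier ext_sum" for c x y
    using total_in_alg_hom that by (simp_all add: alg_hom_def)
  have inv: "total (\<ominus>\<^bsub>ext_sum\<^esub> x) = \<ominus>\<^bsub>B\<^esub> total x" if "x \<in> carrier ext_sum" for x
    using that
    by (intro additive_a_inv[OF E.M.abelian_group_axioms M.abelian_group_axioms]) (auto simp: add)
  have "submodule (a_kernel ext_sum B total) F ext_sum"
    by (rule E.submoduleI) (auto simp: a_kernel_def' total_zero inv add smult)
  then show ?thesis
    by (auto simp: left_ideal_def a_kernel_def' mult E.mult_closed)
qed

text \<open>Each entry of the product contains the factor \<open>total k\<close>, which is zero.
  This is the nilpotency condition that places the kernel in the radical.\<close>

lemma mult_kernel_total_nil:
  assumes "x \<in> carrier ext_sum" "k \<in> a_kernel ext_sum B total"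
  shows "(x \<otimes>\<^bsub>ext_sum\<^esub> k) \<otimes>\<^bsub>ext_sum\<^esub> k = \<zero>\<^bsub>ext_sum\<^esub>"
  using assms
  by (auto intro!: ext_sum_eqI ext_sum_ops_closed simp: a_kernel_def' row_mult)

lemma kernel_total_eq_radical:
  assumes D: "division_algebra F D" and iso: "alg_isomorphic F B (mat_algebra k D)"
    and surj: "total ` carrier ext_sum = carrier B"
  shows "a_kernel ext_sum B total = jacobson_radical F ext_sum"
proof
  interpret E: assoc_algebra F ext_sum
    by (rule assoc_algebra_ext_sum)
  show sub: "a_kernel ext_sum B total \<subseteq> jacobson_radical F ext_sum"
    using left_ideal_kernel_total mult_kernel_total_nil by (rule E.nil_left_ideal_subset_radical)
  obtain g where g: "g \<in> alg_hom F B (mat_algebra k D)"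
    and bij: "bij_betw g (carrier B) (carrier (mat_algebra k D))"
    using iso unfolding alg_isomorphic_def by blast
  have hom: "g \<circ> total \<in> alg_hom F ext_sum (mat_algebra k D)"
    using g total_in_alg_hom by (simp add: alg_hom_def Pi_iff)
  have im: "(g \<circ> total) ` carrier ext_sum = carrier (mat_algebra k D)"
    using bij surj by (metis bij_betw_imp_surj_on image_comp)
  have radical_hom: "(g \<circ> total) x = (\<lambda>p\<in>{1..k} \<times> {1..k}. \<zero>\<^bsub>D\<^esub>)"
    if x: "x \<in> jacobson_radical F ext_sum" for x
  proof -
    have "(g \<circ> total) x \<in> carrier (mat_algebra k D)"
      using x im by (auto simp: jacobson_radical_def)
    then have "(g \<circ> total) x \<in> {1..k} \<times> {1..k} \<rightarrow>\<^sub>E carrier D"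
      by (simp add: mat_algebra_def)
    \<comment> \<open>A matrix is extensional, so the vanishing of all its entries identifies it
      with the zero matrix; for \<open>k = 0\<close> there are no entries to check.\<close>
    then have "(g \<circ> total) x = restrict ((g \<circ> total) x) ({1..k} \<times> {1..k})"
      by (rule PiE_restrict[symmetric])
    also have "\<dots> = (\<lambda>p\<in>{1..k} \<times> {1..k}. \<zero>\<^bsub>D\<^esub>)"
      using jacobson_radical_matrix_entry_zero[OF E.assoc_algebra_axioms D hom im x]
      by (intro restrict_ext) (metis SigmaE)
    finally show ?thesis .
  qed
  show "jacobson_radical F ext_sum \<subseteq> a_kernel ext_sum B total"
  proof
    fix x assume x: "x \<in> jacobson_radical F ext_sum"
    then have xc: "x \<in> carrier ext_sum"
      by (simp add: jacobson_radical_def)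
    \<comment> \<open>Zero lies in the radical too, so \<open>x\<close> and zero have the same image
      under \<open>g \<circ> total\<close>; injectivity of \<open>g\<close> then compares their
      totals.\<close>
    have zero: "\<zero>\<^bsub>ext_sum\<^esub> \<in> jacobson_radical F ext_sum"
      using sub E.left_idealD(2)[OF left_ideal_kernel_total] by blast
    have "g (total x) = g (total \<zero>\<^bsub>ext_sum\<^esub>)"
      using radical_hom[OF x] radical_hom[OF zero] by simp
    then have "total x = total \<zero>\<^bsub>ext_sum\<^esub>"
      using bij xc by (auto simp: bij_betw_def dest: inj_onD)
    then show "x \<in> a_kernel ext_sum B total"
      using xc by (simp add: a_kernel_def' total_zero)
  qed
qed

lemma total_surj:
  assumes "carrier B = sum_of_family B (I \<times> J) (\<lambda>(i, j). C i j)"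
  shows "total ` carrier ext_sum = carrier B"
proof
  show "carrier B \<subseteq> total ` carrier ext_sum"
  proof
    fix b assume "b \<in> carrier B"
    then obtain v where v: "v \<in> Pi (I \<times> J) (\<lambda>(i, j). C i j)" and b: "b = (\<Oplus>\<^bsub>B\<^esub>p\<in>I \<times> J. v p)"
      using assms unfolding sum_of_family_def by blast
    have mem: "v (i, j) \<in> C i j" if "i \<in> I" "j \<in> J" for i j
      using v that by force
    \<comment> \<open>The family \<open>v\<close> comes from \<open>Pi\<close> and is arbitrary
      outside the index set; restricting it gives an extensional family with the same sum.\<close>
    then have "restrict v (I \<times> J) \<in> carrier ext_sum"
      by (rule ext_sum_memI)
    moreover have "b = total (restrict v (I \<times> J))"
      unfolding b total_def using mem by (intro M.finsum_cong') (auto simp: C_closed(1))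
    ultimately show "b \<in> total ` carrier ext_sum"
      by blast
  qed
qed auto

section \<open>Homogeneous components\<close>

definition component :: "'i \<Rightarrow> 'j \<Rightarrow> ('i \<times> 'j \<Rightarrow> 'c) set"
  where "component i j =
    {x \<in> carrier ext_sum. \<forall>k\<in>I. \<forall>l\<in>J. (k, l) \<noteq> (i, j) \<longrightarrow> x (k, l) = \<zero>\<^bsub>B\<^esub>}"

text \<open>The argument \<open>x\<close> need not belong to \<open>ext_sum\<close>: with a constant
  function it embeds a single element of \<open>C i j\<close>.\<close>

definition projection :: "('i \<times> 'j \<Rightarrow> 'c) \<Rightarrow> 'i \<Rightarrow> 'j \<Rightarrow> 'i \<times> 'j \<Rightarrow> 'c"
  where "projection x i j = (\<lambda>p\<in>I \<times> J. if p = (i, j) then x (i, j) else \<zero>\<^bsub>B\<^esub>)"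

lemma projection_apply [simp]:
  "\<lbrakk>k \<in> I; l \<in> J\<rbrakk> \<Longrightarrow> projection x i j (k, l) = (if (k, l) = (i, j) then x (i, j) else \<zero>\<^bsub>B\<^esub>)"
  by (simp add: projection_def)

text \<open>Membership of the entry is required only for indices in range; otherwise the projection
  is the zero family, which lies in every component.\<close>

lemma projection_mem:
  assumes "\<lbrakk>i \<in> I; j \<in> J\<rbrakk> \<Longrightarrow> x (i, j) \<in> C i j"
  shows "projection x i j \<in> component i j"
proof -
  have "projection x i j \<in> carrier ext_sum"
    unfolding projection_def using assms by (intro ext_sum_memI) (auto simp: C_closed)
  then show ?thesis
    by (auto simp: component_def)
qed

lemma componentD:
  assumes "x \<in> component i j"
  shows "x \<in> carrier ext_sum"
    and "\<lbrakk>k \<in> I; l \<in> J; (k, l) \<noteq> (i, j)\<rbrakk> \<Longrightarrow> x (k, l) = \<zero>\<^bsub>B\<^esub>"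
  using assms by (auto simp: component_def)

lemma component_sums:
  assumes "x \<in> component i j" "i \<in> I" "j \<in> J"
  shows row_component: "k \<in> I \<Longrightarrow> row x k = (if k = i then x (i, j) else \<zero>\<^bsub>B\<^esub>)"
    and col_component: "l \<in> J \<Longrightarrow> col x l = (if l = j then x (i, j) else \<zero>\<^bsub>B\<^esub>)"
    and total_component: "total x = x (i, j)"
proof -
  note x = componentD[OF assms(1)]
  note xc = ext_sum_closed[OF x(1)]
  show "row x k = (if k = i then x (i, j) else \<zero>\<^bsub>B\<^esub>)" if k: "k \<in> I"
  proof -
    have "row x k = x (k, j)"
      unfolding row_def using assms(3) fin_J k xc x(2)
      by (intro M.finsum_eq_single[where a = j and f = "\<lambda>j. x (k, j)"]) auto
    then show ?thesis
      using x(2) k assms(3) by auto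
  qed
  show "col x l = (if l = j then x (i, j) else \<zero>\<^bsub>B\<^esub>)" if l: "l \<in> J"
  proof -
    have "col x l = x (i, l)"
      unfolding col_def using assms(2) fin_I l xc x(2)
      by (intro M.finsum_eq_single[where a = i and f = "\<lambda>i. x (i, l)"]) auto
    then show ?thesis
      using x(2) l assms(2) by auto
  qed
  show "total x = x (i, j)"
    unfolding total_def using assms(2,3) fin_I fin_J xc x(2)
    by (intro M.finsum_eq_single) auto
qed

lemma total_image_component:
  assumes "i \<in> I" "j \<in> J"
  shows "total ` component i j = C i j"
proof
  show "total ` component i j \<subseteq> C i j"
    using assms by (auto simp: total_component componentD(1) ext_sum_memD)
  show "C i j \<subseteq> total ` component i j"
  proof
    fix b assume b: "b \<in> C i j"
    let ?x = "projection (\<lambda>_. b) i j"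
    have "?x \<in> component i j"
      using b by (intro projection_mem)
    moreover from this have "total ?x = b"
      using assms by (simp add: total_component)
    ultimately show "b \<in> total ` component i j"
      by (metis image_eqI)
  qed
qed

text \<open>Being supported at one place is preserved by the entrywise operations. For indices out
  of range the component is the zero submodule.\<close>

lemma submodule_component: "submodule (component i j) F ext_sum"
proof -
  interpret E: assoc_algebra F ext_sum
    by (rule assoc_algebra_ext_sum)
  have inv: "(\<ominus>\<^bsub>ext_sum\<^esub> x) (k, l) = \<ominus>\<^bsub>B\<^esub> x (k, l)"
    if "x \<in> carrier ext_sum" "k \<in> I" "l \<in> J" for x k l
    using that
    by (intro additive_a_inv[where h = "\<lambda>x. x (k, l)", OF E.M.abelian_group_axioms M.abelian_group_axioms])
      (auto simp: ext_sum_closed)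
  show ?thesis
    by (rule E.submoduleI) (auto simp: component_def inv)
qed

text \<open>Only row \<open>i\<close> of \<open>x\<close> and column \<open>r\<close> of
  \<open>y\<close> can have nonzero sums, so the product can be nonzero only at
  \<open>(i, r)\<close>.\<close>

lemma component_mult:
  assumes "i \<in> I" "j \<in> J" "l \<in> I" "r \<in> J" and x: "x \<in> component i j" and y: "y \<in> component l r"
  shows "x \<otimes>\<^bsub>ext_sum\<^esub> y = projection (\<lambda>_. x (i, j) \<otimes>\<^bsub>B\<^esub> y (l, r)) i r"
proof (rule ext_sum_eqI)
  note xy = componentD(1)[OF x] componentD(1)[OF y]
  note xyc = ext_sum_closed[OF xy(1)] ext_sum_closed[OF xy(2)]
  show "x \<otimes>\<^bsub>ext_sum\<^esub> y \<in> carrier ext_sum"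
    using xy by (rule ext_sum_ops_closed)
  have "x (i, j) \<otimes>\<^bsub>B\<^esub> y (l, r) \<in> C i r"
    using assms xy by (auto intro: mult_mem ext_sum_memD)
  then show "projection (\<lambda>_. x (i, j) \<otimes>\<^bsub>B\<^esub> y (l, r)) i r \<in> carrier ext_sum"
    by (intro componentD(1)[OF projection_mem])
  fix k s assume "k \<in> I" "s \<in> J"
  then show "(x \<otimes>\<^bsub>ext_sum\<^esub> y) (k, s) = projection (\<lambda>_. x (i, j) \<otimes>\<^bsub>B\<^esub> y (l, r)) i r (k, s)"
    using assms xyc by (simp add: row_component[OF x] col_component[OF y])
qed

end

section \<open>The grading by the Rees matrix semigroup\<close>

lemma rees_graded_ext_sum:
  assumes "rectangular_family F B {1..n} {1..m} C"
    and P: "\<And>i j l r x y. \<lbrakk>i \<in> {1..n}; j \<in> {1..m}; l \<in> {1..n}; r \<in> {1..m}; P j l = Entry_theta;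
             x \<in> C i j; y \<in> C l r\<rbrakk> \<Longrightarrow> x \<otimes>\<^bsub>B\<^esub> y = \<zero>\<^bsub>B\<^esub>"
  defines "E \<equiv> rectangular_family.ext_sum B {1..n} {1..m} C"
    and "V \<equiv> case_rees (rectangular_family.component B {1..n} {1..m} C)
      {\<zero>\<^bsub>rectangular_family.ext_sum B {1..n} {1..m} C\<^esub>}"
  shows "rees_graded_algebra F E n m P V"
proof -
  note One_nat_def [simp del]
  interpret R: rectangular_family F B "{1..n}" "{1..m}" C by fact
  have E: "E = R.ext_sum" and V_Deg: "\<And>i j. V (Deg i j) = R.component i j"
    and V_Theta: "V Theta = {\<zero>\<^bsub>R.ext_sum\<^esub>}"
    by (simp_all add: E_def V_def)
  interpret E: assoc_algebra F R.ext_sum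
    by (rule R.assoc_algebra_ext_sum)
  let ?S = "rees_carrier n m"
  have V_carrier: "v \<in> carrier R.ext_sum" if "v \<in> V s" for v s
    using that by (cases s) (auto simp: V_Deg V_Theta R.componentD(1))
  have V_zero: "v (i, j) = \<zero>\<^bsub>B\<^esub>"
    if "v \<in> V s" "s \<noteq> Deg i j" "i \<in> {1..n}" "j \<in> {1..m}" for v s i j
    using that by (cases s) (auto simp: V_Deg V_Theta R.componentD(2))
  have S: "Deg i j \<in> ?S" if "i \<in> {1..n}" "j \<in> {1..m}" for i j
    using that by (auto simp: rees_carrier_def)
  \<comment> \<open>Evaluation at \<open>(i, j)\<close> is additive, so it passes through the sum
    over degrees, where only the term of degree \<open>Deg i j\<close> survives.\<close>
  have eval: "(\<Oplus>\<^bsub>R.ext_sum\<^esub>s\<in>?S. v s) (i, j) = v (Deg i j) (i, j)"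
    if v: "v \<in> Pi ?S V" and ij: "i \<in> {1..n}" "j \<in> {1..m}" for v i j
  proof -
    have "(\<Oplus>\<^bsub>R.ext_sum\<^esub>s\<in>?S. v s) (i, j) = (\<Oplus>\<^bsub>B\<^esub>s\<in>?S. v s (i, j))"
      using v ij
      by (intro additive_finsum[where h = "\<lambda>x. x (i, j)", OF E.M.abelian_group_axioms
            R.M.abelian_group_axioms]) (auto simp: R.ext_sum_closed intro: V_carrier)
    also have "\<dots> = v (Deg i j) (i, j)"
    proof (rule R.M.finsum_eq_single)
      show "v (Deg i j) (i, j) \<in> carrier B"
        using v ij S[OF ij] V_carrier by (intro R.ext_sum_closed) (auto simp: Pi_iff)
      show "v s (i, j) = \<zero>\<^bsub>B\<^esub>" if "s \<in> ?S" "s \<noteq> Deg i j" for s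
        using v ij that by (intro V_zero) auto
    qed (use S[OF ij] finite_rees_carrier in auto)
    finally show ?thesis .
  qed
  have submod: "submodule (V s) F R.ext_sum" for s
  proof (cases s)
    case Theta
    have "submodule {\<zero>\<^bsub>R.ext_sum\<^esub>} F R.ext_sum"
      by (rule E.submoduleI) auto
    then show ?thesis
      by (simp add: V_Theta Theta)
  qed (simp add: V_Deg R.submodule_component)
  have decomp: "\<exists>!v. v \<in> Pi\<^sub>E ?S V \<and> a = (\<Oplus>\<^bsub>R.ext_sum\<^esub>s\<in>?S. v s)" if a: "a \<in> carrier R.ext_sum" for a
  proof (rule ex1I)
    \<comment> \<open>The decomposition isolates each entry of \<open>a\<close> in its own degree
      and puts zero in degree \<open>Theta\<close>.\<close>
    let ?v = "\<lambda>s\<in>?S. case s of Deg i j \<Rightarrow> R.projection a i j | Theta \<Rightarrow> \<zero>\<^bsub>R.ext_sum\<^esub>"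
    have v: "?v \<in> Pi\<^sub>E ?S V"
      using R.projection_mem[of _ _ a] R.ext_sum_memD[OF a]
      by (simp add: V_Deg V_Theta split: rees.split)
    have v': "?v \<in> Pi ?S V"
      by (rule IntD1[OF v[unfolded PiE_def]])
    have "a = (\<Oplus>\<^bsub>R.ext_sum\<^esub>s\<in>?S. ?v s)"
    proof (rule R.ext_sum_eqI)
      show "(\<Oplus>\<^bsub>R.ext_sum\<^esub>s\<in>?S. ?v s) \<in> carrier R.ext_sum"
        by (intro E.M.finsum_closed funcsetI V_carrier[OF PiE_mem[OF v]])
      show "a (i, j) = (\<Oplus>\<^bsub>R.ext_sum\<^esub>s\<in>?S. ?v s) (i, j)"
        if "i \<in> {1..n}" "j \<in> {1..m}" for i j
        using eval[OF v' that] S[OF that] that by simp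
    qed fact
    with v show "?v \<in> Pi\<^sub>E ?S V \<and> a = (\<Oplus>\<^bsub>R.ext_sum\<^esub>s\<in>?S. ?v s)"
      by blast
    fix w assume w: "w \<in> Pi\<^sub>E ?S V \<and> a = (\<Oplus>\<^bsub>R.ext_sum\<^esub>s\<in>?S. w s)"
    show "w = ?v"
    proof (rule PiE_ext)
      show "w \<in> Pi\<^sub>E ?S V" "?v \<in> Pi\<^sub>E ?S V"
        using w v by blast+
      fix s assume s: "s \<in> ?S"
      have ws: "w s \<in> V s" and vs: "?v s \<in> V s"
        using w v s by (blast intro: PiE_mem)+
      show "w s = ?v s"
      proof (rule R.ext_sum_eqI[OF V_carrier[OF ws] V_carrier[OF vs]])
        fix i j assume ij: "i \<in> {1..n}" "j \<in> {1..m}"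
        show "w s (i, j) = ?v s (i, j)"
        \<comment> \<open>At the matching place \<open>eval\<close> reads off the entry of
          \<open>a\<close>; everywhere else, and always in degree \<open>Theta\<close>, both entries
          vanish.\<close>
        proof (cases "s = Deg i j")
          case True
          have "w (Deg i j) (i, j) = a (i, j)"
            using w ij eval[of w i j] by (simp add: PiE_def)
          then show ?thesis
            using True ij S[OF ij] by simp
        next
          case False
          then show ?thesis
            using V_zero[OF ws _ ij] V_zero[OF vs _ ij] by simp
        qed
      qed
    qed
  qed
  have grade: "x \<otimes>\<^bsub>R.ext_sum\<^esub> y \<in> V (rees_mult P s t)"
    if s: "s \<in> ?S" and t: "t \<in> ?S" and x: "x \<in> V s" and y: "y \<in> V t" for s t x y
  proof (cases "\<exists>i j l r. s = Deg i j \<and> t = Deg l r")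
    case True
    then obtain i j l r where st: "s = Deg i j" "t = Deg l r"
      by blast
    have ij: "i \<in> {1..n}" "j \<in> {1..m}" and lr: "l \<in> {1..n}" "r \<in> {1..m}"
      using s t by (auto simp: st rees_carrier_def)
    have xy: "x \<in> R.component i j" "y \<in> R.component l r"
      using x y by (simp_all add: st V_Deg)
    have mem: "x (i, j) \<in> C i j" "y (l, r) \<in> C l r"
      using xy ij lr by (auto intro: R.ext_sum_memD R.componentD(1))
    let ?z = "R.projection (\<lambda>_. x (i, j) \<otimes>\<^bsub>B\<^esub> y (l, r)) i r"
    have z: "x \<otimes>\<^bsub>R.ext_sum\<^esub> y = ?z"
      using ij lr xy by (rule R.component_mult)
    have zc: "?z \<in> R.component i r"
      using ij lr mem by (intro R.projection_mem) (rule R.mult_mem)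
    show ?thesis
    proof (cases "P j l")
      case Entry_e
      then show ?thesis
        using zc by (simp add: st V_Deg z)
    next
      case Entry_theta
      \<comment> \<open>The only possibly nonzero entry of the product is killed by the vanishing
        hypothesis for \<open>P j l = Entry_theta\<close>, so the product lies in the zero component
        of degree \<open>Theta\<close>.\<close>
      have "?z = \<zero>\<^bsub>R.ext_sum\<^esub>"
        using P[OF ij lr Entry_theta mem] R.componentD(1)[OF zc]
        by (intro R.ext_sum_eqI) auto
      then show ?thesis
        using Entry_theta by (simp add: st V_Theta z)
    qed
  next
    case False
    then have "s = Theta \<or> t = Theta"
      by (metis rees.exhaust)
    moreover from this have "rees_mult P s t = Theta"
      by (cases s; cases t) auto
    ultimately show ?thesis
      using x y V_carrier[OF x] V_carrier[OF y] by (auto simp: V_Theta)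
  qed
  show ?thesis
    unfolding rees_graded_algebra_def graded_algebra_def E
    using R.assoc_algebra_ext_sum submod decomp grade V_Theta by blast
qed

theorem theorem5p2:
  fixes F :: "('f, 'x) ring_scheme"
    and D :: "('f, 'd, 'y) module_scheme"
    and B :: "('f, 'b, 'z) module_scheme"
    and k n m :: nat
    and Bc :: "nat \<Rightarrow> nat \<Rightarrow> 'b set"
    and P :: "nat \<Rightarrow> nat \<Rightarrow> entry"
  assumes "field F"
    and "division_algebra F D"
    and "assoc_algebra F B"
    and "alg_isomorphic F B (mat_algebra k D)"
    and "\<And>i j. \<lbrakk>i \<in> {1..n}; j \<in> {1..m}\<rbrakk> \<Longrightarrow> submodule (Bc i j) F B"
    and "carrier B = sum_of_family B ({1..n} \<times> {1..m}) (\<lambda>(i, j). Bc i j)"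
    and "\<And>i j l r x y. \<lbrakk>i \<in> {1..n}; j \<in> {1..m}; l \<in> {1..n}; r \<in> {1..m}; x \<in> Bc i j; y \<in> Bc l r\<rbrakk>
           \<Longrightarrow> x \<otimes>\<^bsub>B\<^esub> y \<in> Bc i r"
    and "\<And>i j l r x y. \<lbrakk>i \<in> {1..n}; j \<in> {1..m}; l \<in> {1..n}; r \<in> {1..m}; P j l = Entry_theta;
             x \<in> Bc i j; y \<in> Bc l r\<rbrakk> \<Longrightarrow> x \<otimes>\<^bsub>B\<^esub> y = \<zero>\<^bsub>B\<^esub>"
  shows "\<exists>(A :: ('f, nat \<times> nat \<Rightarrow> 'b) module) (V :: rees \<Rightarrow> (nat \<times> nat \<Rightarrow> 'b) set) \<psi>.
           rees_graded_algebra F A n m P V \<and>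
           \<psi> \<in> alg_hom F A B \<and>
           \<psi> ` carrier A = carrier B \<and>
           a_kernel A B \<psi> = jacobson_radical F A \<and>
           (\<forall>i\<in>{1..n}. \<forall>j\<in>{1..m}. \<psi> ` V (Deg i j) = Bc i j)"
proof -
  note One_nat_def [simp del]
  interpret R: rectangular_family F B "{1..n}" "{1..m}" Bc
    using assms(3,5,7) by (intro rectangular_family.intro rectangular_family_axioms.intro) auto
  note surj = R.total_surj[OF assms(6)]
  show ?thesis
  \<comment> \<open>The witnesses are the external direct sum for \<open>A\<close>, its homogeneous
    components with zero in degree \<open>Theta\<close> for \<open>V\<close>, and
    \<open>R.total\<close> for \<psi>.\<close>
  proof (intro exI conjI ballI)
    show "rees_graded_algebra F R.ext_sum n m P (case_rees R.component {\<zero>\<^bsub>R.ext_sum\<^esub>})"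
      using R.rectangular_family_axioms assms(8) by (rule rees_graded_ext_sum)
    show "R.total \<in> alg_hom F R.ext_sum B"
      by (rule R.total_in_alg_hom)
    show "R.total ` carrier R.ext_sum = carrier B"
      by (rule surj)
    show "a_kernel R.ext_sum B R.total = jacobson_radical F R.ext_sum"
      using assms(2,4) surj by (rule R.kernel_total_eq_radical)
    show "R.total ` case_rees R.component {\<zero>\<^bsub>R.ext_sum\<^esub>} (Deg i j) = Bc i j"
      if "i \<in> {1..n}" "j \<in> {1..m}" for i j
      using that by (simp add: R.total_image_component)
  qed
qed

end
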